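(* Let $q$ be a positive rational number that is neither an integer nor the reciprocal of an integer, and let $\alpha = \sqrt[n]{q}$ be a positive irreducible $n$-th root of $q$ (where $n$ is a positive integer). Then the set of Betti elements of the additive monoid $\mathbb{N}_0[\alpha]$ is $$\left\{ \frac{\mathsf{n}(q)^{m+1}}{\mathsf{d}(q)^m}\, \alpha^r \ \Big|\ m \in \mathbb{N}_0 \text{ and } r \in \{0, 1, \dots, n-1\} \right\}.$$
   Context: $\mathbb{N}_0$ is the set of nonnegative integers. For a positive real $\alpha$, $\mathbb{N}_0[\alpha] = \{p(\alpha) \mid p(X) \in \mathbb{N}_0[X]\}$, where $\mathbb{N}_0[X]$ is the set of polynomials with nonnegative integer coefficients; it is regarded as a monoid under addition. For a positive rational $q$, $\mathsf{n}(q)$ and $\mathsf{d}(q)$ denote the unique positive integers with $q = \mathsf{n}(q)/\mathsf{d}(q)$ and $\gcd(\mathsf{n}(q), \mathsf{d}(q)) = 1$. An $n$-th root $\alpha$ of $q$ is called irreducible if $\alpha, \alpha^2, \dots, \alpha^{n-1}$ are all irrational. An atom of $M = \mathbb{N}_0[\alpha]$ is a nonzero element that is not the sum of two nonzero elements of $M$. A factorization of $b \in M$ is a formal sum (finite multiset) of atoms of $M$ whose actual sum is $b$; $\mathsf{Z}(b)$ denotes the set of all factorizations of $b$. For factorizations $z = \sum_a \mu_a a$ and $z' = \sum_a \nu_a a$ (formal sums over atoms), $\gcd(z,z') = \sum_a \min\{\mu_a, \nu_a\} a$. The Betti graph $\nabla_b$ of $b \in M$ is the graph with vertex set $\mathsf{Z}(b)$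 having an edge between $z$ and $z'$ if and only if $\gcd(z,z') \neq 0$ (that is, $z$ and $z'$ share an atom). An element $b \in M$ is a Betti element of $M$ if $\nabla_b$ is disconnected. (Under the hypotheses of the claim $\mathbb{N}_0[\alpha]$ is an atomic monoid, i.e., every nonzero element is a finite sum of atoms, so that these notions apply.) *)

theory Defs
  imports
    Complex_Main
    "HOL-Library.Multiset"
    "HOL-Computational_Algebra.Polynomial"
    "Graph_Theory.Digraph_Component"
begin

definition rat_num :: "rat \<Rightarrow> int" where
  "rat_num q = fst (quotient_of q)"

definition rat_den :: "rat \<Rightarrow> int" where
  "rat_den q = snd (quotient_of q)"

definition irreducible_nth_root :: "nat \<Rightarrow> rat \<Rightarrow> real \<Rightarrow> bool" where
  "irreducible_nth_root n q \<alpha> \<longleftrightarrow>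
     \<alpha> ^ n = of_rat q \<and> (\<forall>k. 1 \<le> k \<and> k \<le> n - 1 \<longrightarrow> \<alpha> ^ k \<notin> \<rat>)"

definition nat_adjoin :: "real \<Rightarrow> real set" where
  "nat_adjoin \<alpha> = {poly (map_poly real p) \<alpha> | p :: nat poly. True}"

text \<open>
  In the following definitions \<open>M\<close> is the carrier of an additive submonoid
  whose only invertible element is \<open>0\<close>.
\<close>

definition atoms :: "'a::comm_monoid_add set \<Rightarrow> 'a set" where
  "atoms M = {a \<in> M. a \<noteq> 0 \<and> \<not> (\<exists>x\<in>M. \<exists>y\<in>M. x \<noteq> 0 \<and> y \<noteq> 0 \<and> a = x + y)}"

definition factorizations :: "'a::comm_monoid_add set \<Rightarrow> 'a \<Rightarrow> 'a multiset set" where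
  "factorizations M b = {z. set_mset z \<subseteq> atoms M \<and> \<Sum>\<^sub># z = b}"

text \<open>
  The greatest common divisor of two factorizations takes the minimum of the
  multiplicities of each atom, so it is the multiset intersection \<open>\<inter>#\<close>.
  The undirected simple graph is encoded as a symmetric loop-free digraph.
\<close>

definition betti_graph :: "'a::comm_monoid_add set \<Rightarrow> 'a \<Rightarrow> 'a multiset pair_pre_digraph" where
  "betti_graph M b =
     \<lparr> pverts = factorizations M b,
       parcs = {(z, z'). z \<in> factorizations M b \<and> z' \<in> factorizations M b \<and>
                         z \<noteq> z' \<and> z \<inter># z' \<noteq> {#}} \<rparr>"

text \<open>
  \<open>Digraph_Component.connected\<close> is graph-theoretic connectedness; a graph
  with a single vertex is connected, so \<open>0\<close> is not a Betti element.
\<close>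

definition betti_elements :: "'a::comm_monoid_add set \<Rightarrow> 'a set" where
  "betti_elements M =
     {b \<in> M. \<not> Digraph_Component.connected (with_proj (betti_graph M b))}"

end

theory Submission
  imports Defs "HOL-Computational_Algebra.Fundamental_Theorem_Algebra"
begin

text \<open>
  Write \<open>q = a / d\<close> in lowest terms, so that \<open>a, d \<ge> 2\<close> and the claimed set is
  \<open>{a \<alpha>\<^sup>i | i}\<close>. All complex roots of \<open>d X\<^sup>n - a\<close> have modulus \<open>\<alpha>\<close>, so an integer
  polynomial of degree \<open>k \<ge> 1\<close> dividing it forces \<open>\<alpha>\<^sup>k\<close> to be rational; hence \<open>k = n\<close>, and
  \<open>d X\<^sup>n - a\<close> generates the ideal of integer polynomials vanishing at \<open>\<alpha>\<close>. The atoms are the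
  powers of \<open>\<alpha>\<close>, a factorization is a finite multiset of exponents, and two multisets have the
  same value if and only if they are connected by trades of \<open>a\<close> copies of \<open>i\<close> against \<open>d\<close> copies of
  \<open>i + n\<close>: performing the trades in the size-decreasing direction leads to a normal form, whose
  uniqueness follows by looking at the lowest or the highest coefficient of a multiple of
  \<open>d X\<^sup>n - a\<close>.

  A trade keeps an atom unless it exchanges the whole multiset, which happens only for
  \<open>b = a \<alpha>\<^sup>i = d \<alpha>\<^sup>i\<^sup>+\<^sup>n\<close>; so all other Betti graphs are connected. For \<open>b = a \<alpha>\<^sup>i\<close> the factorization
  with \<open>min a d\<close> equal atoms is an isolated vertex: what remains of it after removing one atom
  admits no trade at all and therefore has a unique factorization.
\<close>

lemma abs_mult_less_self:
  fixes c x :: int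
  assumes "\<bar>c * x\<bar> < c"
  shows "x = 0"
  using assms zdvd_imp_le[of c "\<bar>c * x\<bar>"] by fastforce

section \<open>Integer polynomials vanishing at a point\<close>

definition eval_int_poly :: "'a::comm_ring_1 \<Rightarrow> int poly \<Rightarrow> 'a" where
  "eval_int_poly x p = poly (map_poly of_int p) x"

lemma map_poly_of_int_add:
  "(map_poly of_int (p + q) :: 'a::comm_ring_1 poly) = map_poly of_int p + map_poly of_int q"
  by (rule poly_eqI) (simp add: coeff_map_poly)

lemma map_poly_of_int_mult:
  "(map_poly of_int (p * q) :: 'a::comm_ring_1 poly) = map_poly of_int p * map_poly of_int q"
  by (rule poly_eqI) (simp add: coeff_map_poly coeff_mult)

lemma eval_int_poly_add: "eval_int_poly x (p + q) = eval_int_poly x p + eval_int_poly x q"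
  by (simp add: eval_int_poly_def map_poly_of_int_add)

lemma eval_int_poly_mult: "eval_int_poly x (p * q) = eval_int_poly x p * eval_int_poly x q"
  by (simp add: eval_int_poly_def map_poly_of_int_mult)

lemma eval_int_poly_monom: "eval_int_poly x (monom c k) = of_int c * x ^ k"
  by (simp add: eval_int_poly_def map_poly_monom poly_monom)

lemma eval_int_poly_0: "eval_int_poly x 0 = 0"
  by (simp add: eval_int_poly_def)

lemma eval_int_poly_diff: "eval_int_poly x (p - q) = eval_int_poly x p - eval_int_poly x q"
  using eval_int_poly_add[of x "p - q" q] by simp

lemma eval_int_poly_smult: "eval_int_poly x (smult c p) = of_int c * eval_int_poly x p"
  using eval_int_poly_mult[of x "[:c:]" p] by (simp add: eval_int_poly_def map_poly_pCons)

text \<open>Gauss's lemma: contents multiply, so \<open>c\<close> divides the content of the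
  cofactor and cancels from both sides.\<close>

lemma primitive_dvd_of_dvd_smult:
  fixes g f :: "int poly"
  assumes "content g = 1" "c \<noteq> 0" "g dvd smult c f"
  shows "g dvd f"
proof -
  from assms(3) obtain s where s: "smult c f = g * s" by (elim dvdE)
  have "c dvd content s"
    using arg_cong[OF s, of content] assms(1)
    by (metis content_mult content_smult dvd_normalize_iff dvd_triv_left mult_1 normalize_dvd_iff)
  then obtain t where t: "s = [:c:] * t"
    unfolding const_poly_dvd_iff_dvd_content[symmetric] by (elim dvdE)
  have "smult c f = smult c (g * t)" using s t by simp
  with assms(2) show ?thesis by (metis dvd_triv_left smult_cancel)
qed

text \<open>The generator is the primitive part of a nonzero polynomial of least degree vanishing at
  \<open>x\<close>. Over the integers only pseudo-division is available: its remainder is 0 by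
  minimality, and the factor \<open>a\<close> that it introduces is removed by
  \<open>primitive_dvd_of_dvd_smult\<close>.\<close>

lemma min_int_poly_exists:
  fixes x :: "'a::{idom, ring_char_0}"
  assumes "f0 \<noteq> 0" "eval_int_poly x f0 = 0"
  obtains g where "g \<noteq> 0" "eval_int_poly x g = 0"
    "\<And>f. eval_int_poly x f = 0 \<Longrightarrow> g dvd f"
proof -
  define P where "P g \<longleftrightarrow> g \<noteq> 0 \<and> eval_int_poly x g = 0" for g
  obtain g0 where g0: "P g0" and min: "\<And>g. P g \<Longrightarrow> degree g0 \<le> degree g"
    using assms ex_has_least_nat[of P f0 degree] unfolding P_def by blast
  define g where "g = primitive_part g0"
  have eq: "g0 = smult (content g0) g" by (simp add: g_def)
  have g: "g \<noteq> 0" "content g = 1" "degree g = degree g0"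
    using g0 eq unfolding P_def by (auto simp: g_def content_primitive_part)
  have ev: "eval_int_poly x g = 0"
  proof -
    have "of_int (content g0) * eval_int_poly x g = 0"
      using g0 eq unfolding P_def by (metis eval_int_poly_smult)
    thus ?thesis using g0 unfolding P_def by simp
  qed
  have "g dvd f" if f: "eval_int_poly x f = 0" for f
  proof -
    define r where "r = pseudo_mod f g"
    obtain a s where as: "a \<noteq> 0" "smult a f = g * s + r"
      using pseudo_mod(1)[OF g(1), of f] unfolding r_def by blast
    have "eval_int_poly x r = 0"
      using arg_cong[OF as(2), of "eval_int_poly x"] ev f
      by (simp add: eval_int_poly_smult eval_int_poly_add eval_int_poly_mult)
    moreover have "r = 0 \<or> degree r < degree g"
      using pseudo_mod(2)[OF g(1), of f] unfolding r_def .
    ultimately have "r = 0" using min[of r] g(3) unfolding P_def by linarith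
    thus ?thesis using as primitive_dvd_of_dvd_smult[OF g(2) as(1)] by simp
  qed
  thus ?thesis using that g(1) ev by blast
qed

text \<open>Vieta: up to sign, the constant coefficient is the leading one times the product of all
  roots with multiplicity.\<close>

lemma norm_coeff_0_of_equal_root_norms:
  fixes P :: "complex poly"
  assumes "\<And>z. poly P z = 0 \<Longrightarrow> norm z = \<rho>"
  shows "norm (coeff P 0) = norm (lead_coeff P) * \<rho> ^ degree P"
proof (cases "P = 0")
  case False
  then obtain A where A: "size A = degree P" "P = smult (lead_coeff P) (\<Prod>x\<in>#A. [:-x, 1:])"
    using alg_closed_imp_factorization by blast
  have *: "norm (poly (\<Prod>x\<in>#B. [:-x, 1:]) 0) = \<rho> ^ size B"
    if "\<forall>x\<in>#B. norm x = \<rho>" for B :: "complex multiset"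
    using that by (induction B) (auto simp: norm_mult)
  have "\<forall>x\<in>#A. poly P x = 0"
  proof
    fix x assume "x \<in># A"
    then obtain B where "A = add_mset x B" by (metis multi_member_split)
    hence "P = smult (lead_coeff P) ([:-x, 1:] * (\<Prod>x\<in>#B. [:-x, 1:]))" using A(2) by simp
    hence "poly P x = poly (smult (lead_coeff P) ([:-x, 1:] * (\<Prod>x\<in>#B. [:-x, 1:]))) x"
      by (rule arg_cong)
    thus "poly P x = 0" by simp
  qed
  hence "norm (poly (\<Prod>x\<in>#A. [:-x, 1:]) 0) = \<rho> ^ size A" using * assms by blast
  moreover have "poly P 0 = lead_coeff P * poly (\<Prod>x\<in>#A. [:-x, 1:]) 0"
    by (subst A(2)) simp
  ultimately show ?thesis by (simp add: norm_mult A(1) poly_0_coeff_0)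
qed auto

section \<open>The ideal of integer polynomials vanishing at \<alpha>\<close>

locale irreducible_root =
  fixes a d n :: nat and \<alpha> :: real
  assumes a_ge_2: "a \<ge> 2" and d_ge_2: "d \<ge> 2" and coprime: "coprime a d"
    and n_pos: "n \<ge> 1" and \<alpha>_pos: "\<alpha> > 0" and root: "d * \<alpha> ^ n = a"
    and irrational: "\<And>k. 1 \<le> k \<Longrightarrow> k < n \<Longrightarrow> \<alpha> ^ k \<notin> \<rat>"
begin

definition root_poly :: "int poly" where
  "root_poly = monom (int d) n - monom (int a) 0"

lemma coeff_root_poly:
  "coeff root_poly j = (if j = n then int d else 0) - (if j = 0 then int a else 0)"
  by (auto simp: root_poly_def)

lemma root_poly_nonzero: "root_poly \<noteq> 0"
  using coeff_root_poly[of 0] n_pos a_ge_2 by auto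

lemma degree_root_poly: "degree root_poly = n"
  using n_pos d_ge_2 by (intro antisym degree_le le_degree) (auto simp: coeff_root_poly)

lemma eval_root_poly: "eval_int_poly x root_poly = of_nat d * x ^ n - of_nat a"
  by (simp add: root_poly_def eval_int_poly_diff eval_int_poly_monom)

lemma content_root_poly: "content root_poly = 1"
proof -
  have "content root_poly dvd int d" "content root_poly dvd int a"
    using content_dvd_coeff[of root_poly n] content_dvd_coeff[of root_poly 0] n_pos
    by (auto simp: coeff_root_poly)
  moreover have "coprime (int a) (int d)" using coprime by simp
  ultimately have "is_unit (content root_poly)" by (meson coprime_common_divisor)
  thus ?thesis by (simp only: is_unit_content_iff)
qed

lemma norm_complex_root:
  assumes "eval_int_poly z root_poly = (0::complex)"
  shows "norm z = \<alpha>"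
proof -
  have "of_nat d * z ^ n = of_nat a" using assms by (simp add: eval_root_poly)
  hence "real d * norm z ^ n = real a" by (metis norm_mult norm_of_nat norm_power)
  hence "norm z ^ n = \<alpha> ^ n"
    using root d_ge_2 by (metis mult_cancel_left of_nat_0_eq_iff not_numeral_le_zero)
  thus ?thesis using power_eq_imp_eq_base[of "norm z" n \<alpha>] \<alpha>_pos n_pos by simp
qed

lemma degree_divisor_root_poly:
  assumes "g dvd root_poly" "degree g \<noteq> 0"
  shows "degree g = n"
proof -
  have "g \<noteq> 0" using assms by auto
  let ?P = "map_poly of_int g :: complex poly"
  have "norm z = \<alpha>" if "poly ?P z = 0" for z
    using that assms(1) norm_complex_root
    by (metis eval_int_poly_def eval_int_poly_mult dvdE mult_zero_left)
  hence "norm (coeff ?P 0) = norm (lead_coeff ?P) * \<alpha> ^ degree ?P"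
    by (rule norm_coeff_0_of_equal_root_norms)
  hence "\<bar>real_of_int (coeff g 0)\<bar> = \<bar>real_of_int (lead_coeff g)\<bar> * \<alpha> ^ degree g"
    by (simp add: degree_map_poly coeff_map_poly)
  hence "\<alpha> ^ degree g = \<bar>real_of_int (coeff g 0)\<bar> / \<bar>real_of_int (lead_coeff g)\<bar>"
    using \<open>g \<noteq> 0\<close> by (simp add: field_simps)
  hence "\<alpha> ^ degree g \<in> \<rat>" by simp
  hence "degree g \<ge> n" using irrational[of "degree g"] assms(2) by force
  moreover have "degree g \<le> n"
    using dvd_imp_degree_le[OF assms(1) root_poly_nonzero] degree_root_poly by simp
  ultimately show ?thesis by simp
qed

text \<open>The generator \<open>g\<close> from \<open>min_int_poly_exists\<close> divides
  \<open>root_poly\<close> and is not constant, so both have degree \<open>n\<close>. The cofactor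
  is then a constant, and a unit because \<open>root_poly\<close> has content 1.\<close>

lemma root_poly_dvd:
  assumes "eval_int_poly \<alpha> f = 0"
  shows "root_poly dvd f"
proof -
  have "eval_int_poly \<alpha> root_poly = 0" using root by (simp add: eval_root_poly)
  with root_poly_nonzero obtain g where g: "g \<noteq> 0" "eval_int_poly \<alpha> g = 0"
    "\<And>f. eval_int_poly \<alpha> f = 0 \<Longrightarrow> g dvd f"
    using min_int_poly_exists[of root_poly \<alpha>] by blast
  have dvd: "g dvd root_poly" using g(3) root by (simp add: eval_root_poly)
  have "degree g \<noteq> 0"
  proof
    assume "degree g = 0"
    then obtain c where "g = [:c:]" by (elim degree_eq_zeroE)
    thus False using g by (simp add: eval_int_poly_def map_poly_pCons)
  qed
  hence deg: "degree g = n" using degree_divisor_root_poly[OF dvd] by simp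
  from dvd obtain s where s: "root_poly = g * s" by (elim dvdE)
  have "s \<noteq> 0" using s root_poly_nonzero by auto
  hence "degree s = 0"
    using arg_cong[OF s, of degree] deg degree_root_poly g(1) by (simp add: degree_mult_eq)
  then obtain c where c: "s = [:c:]" by (elim degree_eq_zeroE)
  have "is_unit c"
    using arg_cong[OF s, of content] content_root_poly c
    by (metis content_const content_mult dvd_triv_right normalize_dvd_iff)
  hence "root_poly dvd g"
    using s c by (metis dvd_refl is_unit_const_poly_iff mult_unit_dvd_iff)
  thus ?thesis using g(3)[OF assms] dvd_trans by blast
qed

lemma coeff_root_poly_mult:
  "coeff (root_poly * h) j =
    (if n \<le> j then int d * coeff h (j - n) else 0) - int a * coeff h j"
  by (simp add: root_poly_def left_diff_distrib coeff_monom_mult)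

section \<open>Multisets of exponents, their values and their normal forms\<close>

definition val :: "nat multiset \<Rightarrow> real" where
  "val N = (\<Sum>i\<in>#N. \<alpha> ^ i)"

lemma val_empty [simp]: "val {#} = 0"
  and val_add_mset [simp]: "val (add_mset i N) = \<alpha> ^ i + val N"
  and val_union [simp]: "val (N + N') = val N + val N'"
  by (simp_all add: val_def)

lemma val_replicate [simp]: "val (replicate_mset k i) = real k * \<alpha> ^ i"
  by (induction k) (simp_all add: algebra_simps)

lemma val_pos: "N \<noteq> {#} \<Longrightarrow> val N > 0"
proof (induction N)
  case (add i N)
  then show ?case using \<alpha>_pos by (cases "N = {#}") (auto intro: add_pos_pos)
qed simp

text \<open>\<open>P N\<close> has the multiplicities of \<open>N\<close> as coefficients and takes
  the value \<open>val N\<close> at \<alpha>, so the difference of two such polynomials of equal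
  value lies in the ideal generated by \<open>root_poly\<close>.\<close>

lemma val_eq_imp_root_poly_mult:
  assumes "val N = val N'"
  obtains h where "\<And>j. int (count N j) - int (count N' j) = coeff (root_poly * h) j"
proof -
  define P :: "nat multiset \<Rightarrow> int poly" where "P N = (\<Sum>i\<in>#N. monom 1 i)" for N
  have coeff_P: "coeff (P N) j = int (count N j)" for N j
    by (induction N) (auto simp: P_def)
  have eval_P: "eval_int_poly \<alpha> (P N) = val N" for N
    by (induction N)
      (auto simp: P_def eval_int_poly_0 eval_int_poly_add eval_int_poly_monom)
  have "eval_int_poly \<alpha> (P N - P N') = 0" using assms by (simp add: eval_int_poly_diff eval_P)
  then obtain h where "P N - P N' = root_poly * h" using root_poly_dvd by (meson dvdE)
  hence "coeff (P N - P N') j = coeff (root_poly * h) j" for j by simp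
  with that show thesis by (simp add: coeff_P)
qed

text \<open>The coefficients of \<open>h\<close> vanish from the bottom upwards: once coefficient
  \<open>j - n\<close> is zero, \<open>a\<close> times coefficient \<open>j\<close> is a difference
  of two counts below \<open>a\<close>, hence zero.\<close>

lemma multiset_eq_if_counts_lt_a:
  assumes "val N = val N'" "\<And>j. count N j < a" "\<And>j. count N' j < a"
  shows "N = N'"
proof -
  obtain h where h: "\<And>j. int (count N j) - int (count N' j) = coeff (root_poly * h) j"
    using val_eq_imp_root_poly_mult[OF assms(1)] by blast
  have "coeff h j = 0" for j
  proof (induction j rule: less_induct)
    case (less j)
    have "(if n \<le> j then int d * coeff h (j - n) else 0) = 0"
      using less[of "j - n"] n_pos by auto
    hence "int a * coeff h j = int (count N' j) - int (count N j)"
      using h[of j] unfolding coeff_root_poly_mult by linarith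
    moreover have "\<bar>int (count N' j) - int (count N j)\<bar> < int a"
      using assms(2,3)[of j] by linarith
    ultimately have "\<bar>int a * coeff h j\<bar> < int a" by simp
    thus ?case using abs_mult_less_self by blast
  qed
  hence "h = 0" by (simp add: poly_eq_iff)
  thus ?thesis using h by (intro multiset_eqI) simp
qed

text \<open>The mirror image, read from the top of \<open>h\<close>. The bound concerns the
  exponents from \<open>n\<close> on because these are the ones at which a trade can be
  undone.\<close>

lemma multiset_eq_if_counts_lt_d:
  assumes "val N = val N'" "\<And>j. n \<le> j \<Longrightarrow> count N j < d" "\<And>j. n \<le> j \<Longrightarrow> count N' j < d"
  shows "N = N'"
proof -
  obtain h where h: "\<And>j. int (count N j) - int (count N' j) = coeff (root_poly * h) j"
    using val_eq_imp_root_poly_mult[OF assms(1)] by blast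
  \<comment> \<open>For nonzero \<open>h\<close> this is the degree of the product. As
    \<open>n \<ge> 1\<close>, the \<open>a\<close> term drops out here and
    \<open>d * lead_coeff h\<close> remains.\<close>
  let ?j = "degree h + n"
  have "coeff h ?j = 0" using n_pos by (intro coeff_eq_0) simp
  hence "int d * lead_coeff h = int (count N ?j) - int (count N' ?j)"
    using h[of ?j] unfolding coeff_root_poly_mult by simp
  moreover have "\<bar>int (count N ?j) - int (count N' ?j)\<bar> < int d"
    using assms(2,3)[of ?j] by linarith
  ultimately have "\<bar>int d * lead_coeff h\<bar> < int d" by simp
  hence "h = 0" using abs_mult_less_self leading_coeff_0_iff by blast
  thus ?thesis using h by (intro multiset_eqI) simp
qed

text \<open>This is the relation \<open>d * \<alpha> ^ n = a\<close>, multiplied by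
  \<open>\<alpha> ^ i\<close> and applied inside a multiset. \<open>R\<close> is the part that both
  sides keep; if nonempty, it supplies a common atom.\<close>

inductive trade :: "nat multiset \<Rightarrow> nat multiset \<Rightarrow> bool" where
  "trade (replicate_mset a i + R) (replicate_mset d (i + n) + R)"

lemma val_trade: "trade N N' \<Longrightarrow> val N = val N'"
proof (induction rule: trade.induct)
  case (1 i R)
  have "real d * \<alpha> ^ (i + n) = \<alpha> ^ i * (real d * \<alpha> ^ n)" by (simp add: power_add)
  thus ?case using root by simp
qed

lemma val_equivclp_trade: "equivclp trade N N' \<Longrightarrow> val N = val N'"
  by (induction rule: equivclp_induct) (auto dest: val_trade)

lemma reduce_counts_lt_a:
  assumes "d < a"
  shows "\<exists>N'. equivclp trade N N' \<and> (\<forall>j. count N' j < a)"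
proof (induction "size N" arbitrary: N rule: less_induct)
  case less
  show ?case
  proof (cases "\<forall>j. count N j < a")
    case False
    then obtain i where "replicate_mset a i \<subseteq># N"
      by (auto simp: not_less count_le_replicate_mset_subset_eq)
    then obtain R where R: "N = replicate_mset a i + R" by (auto simp: mset_subset_eq_exists_conv)
    let ?N = "replicate_mset d (i + n) + R"
    have "trade N ?N" unfolding R by (rule trade.intros)
    moreover have "size ?N < size N" using assms by (simp add: R)
    moreover from less[OF this] obtain N' where "equivclp trade ?N N'" "\<forall>j. count N' j < a" by blast
    ultimately show ?thesis by (blast intro: equivclp_trans r_into_equivclp)
  qed (auto intro: equivclp_refl)
qed

lemma reduce_counts_lt_d:
  assumes "a < d"
  shows "\<exists>N'. equivclp trade N N' \<and> (\<forall>j\<ge>n. count N' j < d)"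
proof (induction "size N" arbitrary: N rule: less_induct)
  case less
  show ?case
  proof (cases "\<forall>j\<ge>n. count N j < d")
    case False
    then obtain j where "n \<le> j" "replicate_mset d j \<subseteq># N"
      by (auto simp: not_less count_le_replicate_mset_subset_eq)
    then obtain i R where R: "N = replicate_mset d (i + n) + R"
      by (metis mset_subset_eq_exists_conv le_add_diff_inverse2)
    let ?N = "replicate_mset a i + R"
    have "trade ?N N" unfolding R by (rule trade.intros)
    moreover have "size ?N < size N" using assms by (simp add: R)
    moreover from less[OF this] obtain N' where "equivclp trade ?N N'" "\<forall>j\<ge>n. count N' j < d" by blast
    ultimately show ?thesis by (blast intro: equivclp_trans converse_r_into_equivclp)
  qed (auto intro: equivclp_refl)
qed

lemma val_eq_iff_equivclp_trade: "val N = val N' \<longleftrightarrow> equivclp trade N N'"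
proof
  assume eq: "val N = val N'"
  \<comment> \<open>Since the two numbers differ, trades in one direction shrink the multiset, which
    selects the normal form to use.\<close>
  have "a \<noteq> d" using coprime a_ge_2 by auto
  then consider "d < a" | "a < d" by linarith
  then obtain R R' where "equivclp trade N R" "equivclp trade N' R'" "R = R'"
  proof cases
    case 1
    then obtain R R' where R: "equivclp trade N R" "equivclp trade N' R'"
      "\<forall>j. count R j < a" "\<forall>j. count R' j < a"
      using reduce_counts_lt_a by meson
    moreover have "R = R'"
      using R eq by (intro multiset_eq_if_counts_lt_a) (auto dest!: val_equivclp_trade)
    ultimately show ?thesis using that by blast
  next
    case 2
    then obtain R R' where R: "equivclp trade N R" "equivclp trade N' R'"
      "\<forall>j\<ge>n. count R j < d" "\<forall>j\<ge>n. count R' j < d"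
      using reduce_counts_lt_d by meson
    moreover have "R = R'"
      using R eq by (intro multiset_eq_if_counts_lt_d) (auto dest!: val_equivclp_trade)
    ultimately show ?thesis using that by blast
  qed
  thus "equivclp trade N N'" by (meson equivclp_sym equivclp_trans)
qed (rule val_equivclp_trade)

text \<open>A trade out of \<open>R\<close> needs \<open>a\<close> equal exponents in
  \<open>R\<close>, a trade into \<open>R\<close> leaves \<open>d\<close> equal ones there. So no
  trade touches \<open>R\<close>, and its class is a singleton.\<close>

lemma unique_if_counts_small:
  assumes "val R = val N" "\<And>i. count R i < a" "\<And>i. count R i < d"
  shows "N = R"
proof -
  have "equivclp trade R N" using assms(1) by (simp add: val_eq_iff_equivclp_trade)
  thus ?thesis
  proof (induction rule: equivclp_induct)
    case (step y z)
    have False if "trade R z \<or> trade z R"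
      using that
    proof
      assume "trade R z"
      then obtain i where "count R i \<ge> a" by cases (metis count_replicate_mset count_union le_add1)
      thus False using assms(2)[of i] by simp
    next
      assume "trade z R"
      then obtain i where "count R i \<ge> d" by cases (metis count_replicate_mset count_union le_add1)
      thus False using assms(3)[of i] by simp
    qed
    with step show ?case by blast
  qed simp
qed

text \<open>This yields both that distinct exponents give distinct powers and that every power of
  \<alpha> is an atom.\<close>

lemma unique_singleton: "val N = \<alpha> ^ i \<Longrightarrow> N = {#i#}"
  using a_ge_2 d_ge_2 by (intro unique_if_counts_small) auto

lemma inj_power: "inj ((^) \<alpha>)"
proof
  fix i j assume "\<alpha> ^ i = \<alpha> ^ j"
  thus "i = j" using unique_singleton[of "{#i#}" j] by simp
qed

section \<open>The monoid, its atoms and its factorizations\<close>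

lemma nat_adjoin_eq: "nat_adjoin \<alpha> = range val"
proof safe
  fix x assume "x \<in> nat_adjoin \<alpha>"
  then obtain p :: "nat poly" where x: "x = poly (map_poly real p) \<alpha>"
    by (auto simp: nat_adjoin_def)
  have "val (\<Sum>i\<in>A. replicate_mset (c i) i) = (\<Sum>i\<in>A. real (c i) * \<alpha> ^ i)"
    if "finite A" for A c
    using that by (induction A) auto
  hence "x = val (\<Sum>i\<le>degree p. replicate_mset (coeff p i) i)"
    unfolding x poly_altdef by (simp add: degree_map_poly coeff_map_poly)
  thus "x \<in> range val" by simp
next
  fix N show "val N \<in> nat_adjoin \<alpha>"
  proof (induction N)
    case empty
    have "0 = poly (map_poly real 0) \<alpha>" by simp
    thus ?case unfolding nat_adjoin_def val_empty by blast
  next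
    case (add i N)
    then obtain p where p: "val N = poly (map_poly real p) \<alpha>" by (auto simp: nat_adjoin_def)
    have "map_poly real (monom 1 i + p) = monom 1 i + map_poly real p"
      by (rule poly_eqI) (simp add: coeff_map_poly)
    hence "val (add_mset i N) = poly (map_poly real (monom 1 i + p)) \<alpha>"
      by (simp add: p poly_monom)
    thus ?case unfolding nat_adjoin_def by blast
  qed
qed

lemma atoms_eq: "atoms (nat_adjoin \<alpha>) = range ((^) \<alpha>)"
proof safe
  fix x assume x: "x \<in> atoms (nat_adjoin \<alpha>)"
  then obtain N where N: "x = val N" "x \<noteq> 0" by (auto simp: atoms_def nat_adjoin_eq)
  then obtain i R where R: "N = add_mset i R" by (cases N) auto
  have "R = {#}"
  proof (rule ccontr)
    assume "R \<noteq> {#}"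
    hence "val R \<noteq> 0" "val {#i#} \<noteq> 0" using val_pos[of R] \<alpha>_pos by simp_all
    moreover have "x = val {#i#} + val R" using N R by simp
    ultimately show False using x unfolding atoms_def nat_adjoin_eq by blast
  qed
  thus "x \<in> range ((^) \<alpha>)" using N R by simp
next
  fix i
  have "\<alpha> ^ i = val {#i#}" by simp
  moreover have False if "\<alpha> ^ i = val N + val N'" "val N \<noteq> 0" "val N' \<noteq> 0" for N N'
  proof -
    \<comment> \<open>Values add under union. If the union is a singleton, one of its parts is empty
      and has value 0.\<close>
    have "N + N' = {#i#}" using that by (intro unique_singleton) simp
    thus False using that by (auto simp: union_is_single)
  qed
  ultimately show "\<alpha> ^ i \<in> atoms (nat_adjoin \<alpha>)"
    using \<alpha>_pos unfolding atoms_def nat_adjoin_eq by fastforce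
qed

lemma factorizations_eq:
  "factorizations (nat_adjoin \<alpha>) b = image_mset ((^) \<alpha>) ` {N. val N = b}"
proof safe
  fix z assume z: "z \<in> factorizations (nat_adjoin \<alpha>) b"
  \<comment> \<open>Every atom is a power of \<alpha>, so choosing exponents by \<open>inv\<close>
    and taking powers again gives back \<open>z\<close>.\<close>
  define N where "N = image_mset (inv ((^) \<alpha>)) z"
  have "image_mset ((^) \<alpha>) N = image_mset id z"
    unfolding N_def multiset.map_comp
    using z by (intro image_mset_cong) (auto simp: factorizations_def atoms_eq f_inv_into_f)
  hence N: "z = image_mset ((^) \<alpha>) N" by simp
  moreover have "val N = b" using z unfolding factorizations_def val_def N by simp
  ultimately show "z \<in> image_mset ((^) \<alpha>) ` {N. val N = b}" by blast
qed (auto simp: factorizations_def val_def atoms_eq)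

lemma Int_image_mset_nonempty_iff:
  "image_mset ((^) \<alpha>) N \<inter># image_mset ((^) \<alpha>) N' \<noteq> {#} \<longleftrightarrow> (\<exists>i. i \<in># N \<and> i \<in># N')"
  using inj_power by (auto simp: disjunct_not_in inj_eq)

section \<open>Betti elements\<close>

lemma a_times_power_eq: "real a * \<alpha> ^ i = real d * \<alpha> ^ (i + n)"
  using val_trade[OF trade.intros[of i "{#}"]] by simp

lemma a_times_power_betti: "real a * \<alpha> ^ i \<in> betti_elements (nat_adjoin \<alpha>)"
proof -
  let ?b = "real a * \<alpha> ^ i" and ?f = "image_mset ((^) \<alpha>)"
  have neq: "replicate_mset a i \<noteq> replicate_mset d (i + n)"
    using n_pos a_ge_2
    by (metis count_replicate_mset not_numeral_le_zero add_eq_self_zero not_one_le_zero)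
  \<comment> \<open>\<open>c\<close> is the minimum of \<open>a\<close> and \<open>d\<close>. Of the
    two factorizations, \<open>a\<close> copies of \<open>i\<close> and \<open>d\<close> copies of
    \<open>i + n\<close>, the one with \<open>c\<close> copies is to be isolated and
    \<open>N\<close> is the other.\<close>
  obtain c j N where j: "c \<le> a" "c \<le> d" "c > 0" "val (replicate_mset c j) = ?b"
    and N: "val N = ?b" "N \<noteq> replicate_mset c j"
  proof (cases "a \<le> d")
    case True
    thus ?thesis using that[of a i "replicate_mset d (i + n)"] neq a_times_power_eq[of i] a_ge_2 by fastforce
  next
    case False
    thus ?thesis using that[of d "i + n" "replicate_mset a i"] neq a_times_power_eq[of i] d_ge_2 by fastforce
  qed
  let ?Z = "replicate_mset c j"
  \<comment> \<open>A \<open>W\<close> meeting \<open>?Z\<close> contains \<open>j\<close>. Removing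
    one \<open>j\<close> from both leaves \<open>c - 1\<close> copies in \<open>?Z\<close>, fewer
    than \<open>a\<close> and than \<open>d\<close>, so \<open>unique_if_counts_small\<close>
    applies.\<close>
  have isolated: "W = ?Z" if W: "val W = ?b" "\<exists>k. k \<in># W \<and> k \<in># ?Z" for W
  proof -
    from W(2) have "j \<in># W" by (auto split: if_splits)
    then obtain W' where W': "W = add_mset j W'" by (metis multi_member_split)
    obtain c' where c': "c = Suc c'" using j(3) by (cases c) auto
    have "W' = replicate_mset c' j"
      using W(1) j c' by (intro unique_if_counts_small) (auto simp: W')
    thus ?thesis by (simp add: W' c')
  qed
  have in_F: "?f N \<in> factorizations (nat_adjoin \<alpha>) ?b" "?f ?Z \<in> factorizations (nat_adjoin \<alpha>) ?b"
    using N j unfolding factorizations_eq by blast+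
  have "?f N = ?f ?Z" if conn: "Digraph_Component.connected (with_proj (betti_graph (nat_adjoin \<alpha>) ?b))"
  proof -
    \<comment> \<open>Connectedness would give a walk from \<open>?f ?Z\<close> to
      \<open>?f N\<close>, but by induction a walk never leaves the isolated vertex.\<close>
    have "(?f ?Z, ?f N) \<in> rtrancl_on (factorizations (nat_adjoin \<alpha>) ?b)
        ((parcs (betti_graph (nat_adjoin \<alpha>) ?b))\<^sup>s)"
      using conn in_F unfolding connected_conv by (simp add: betti_graph_def arcs_ends_conv)
    thus ?thesis
    proof (induction rule: rtrancl_on_induct)
      case (step y z)
      then obtain W where W: "val W = ?b" "z = ?f W" by (auto simp: factorizations_eq)
      from step have "y \<inter># z \<noteq> {#}"
        by (auto simp: symcl_def betti_graph_def subset_mset.inf_commute)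
      hence "\<exists>k. k \<in># W \<and> k \<in># ?Z"
        unfolding step.IH W(2) Int_image_mset_nonempty_iff by blast
      thus ?case using isolated W by simp
    qed simp
  qed
  moreover have "?f N \<noteq> ?f ?Z" using N(2) inj_power by (meson multiset.inj_map injD)
  moreover have "?b \<in> nat_adjoin \<alpha>" unfolding nat_adjoin_eq using N(1) by (metis rangeI)
  ultimately show ?thesis unfolding betti_elements_def by blast
qed

lemma betti_imp_a_times_power:
  assumes "b \<in> betti_elements (nat_adjoin \<alpha>)"
  shows "\<exists>i. b = real a * \<alpha> ^ i"
proof (rule ccontr)
  assume not: "\<nexists>i. b = real a * \<alpha> ^ i"
  let ?f = "image_mset ((^) \<alpha>)" and ?F = "factorizations (nat_adjoin \<alpha>) b"
  let ?E = "(parcs (betti_graph (nat_adjoin \<alpha>) b))\<^sup>s"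
  \<comment> \<open>The graph has no loops, hence the condition \<open>neq\<close>. Where it fails
    along a chain of trades, the path does not grow.\<close>
  have edge: "(?f N, ?f N') \<in> ?E" 
    if val_N: "val N = b" and tr: "trade N N' \<or> trade N' N" and neq: "?f N \<noteq> ?f N'" for N N'
  proof -
    have vals: "val N = b" "val N' = b" using val_N tr val_trade by auto
    obtain i R where R: "{N, N'} = {replicate_mset a i + R, replicate_mset d (i + n) + R}"
      using tr by (auto elim!: trade.cases)
    have "val (replicate_mset a i + R) = b" using R vals by (auto simp: doubleton_eq_iff)
    \<comment> \<open>With \<open>R\<close> empty, \<open>b\<close> would be
      \<open>a * \<alpha> ^ i\<close>.\<close>
    hence "R \<noteq> {#}" using not by auto
    then obtain k where "k \<in># R" by blast
    hence "k \<in># N \<and> k \<in># N'" using R by (auto simp: doubleton_eq_iff)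
    hence "?f N \<inter># ?f N' \<noteq> {#}" using Int_image_mset_nonempty_iff by blast
    thus ?thesis using vals neq by (auto simp: symcl_def betti_graph_def factorizations_eq)
  qed
  have path: "(?f N, ?f N') \<in> rtrancl_on ?F ?E" if "val N = b" "val N' = b" for N N'
  proof -
    have "equivclp trade N N'" using that by (simp add: val_eq_iff_equivclp_trade[symmetric])
    thus ?thesis
    proof (induction rule: equivclp_induct)
      case base
      show ?case using that(1) by (auto simp: factorizations_eq)
    next
      case (step y z)
      have y: "val y = b" using step(1) that(1) val_equivclp_trade by metis
      hence "val z = b" using step(2) val_trade by metis
      hence "?f z \<in> ?F" by (auto simp: factorizations_eq)
      thus ?case using step edge[OF y step(2)] rtrancl_on_into_rtrancl_on by (metis (no_types))
    qed
  qed
  \<comment> \<open>Connectedness also asks for at least one vertex; \<open>b\<close> has a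
    factorization because it lies in the monoid.\<close>
  have "b \<in> range val" using assms by (simp add: betti_elements_def nat_adjoin_eq)
  hence "?F \<noteq> {}" by (auto simp: factorizations_eq)
  moreover have "\<forall>u\<in>?F. \<forall>v\<in>?F. (u, v) \<in> rtrancl_on ?F ?E"
    using path by (auto simp: factorizations_eq)
  ultimately have "Digraph_Component.connected (with_proj (betti_graph (nat_adjoin \<alpha>) b))"
    unfolding connected_conv by (simp add: betti_graph_def arcs_ends_conv)
  thus False using assms by (simp add: betti_elements_def)
qed

lemma betti_elements_eq: "betti_elements (nat_adjoin \<alpha>) = {real a * \<alpha> ^ i | i. True}"
  using a_times_power_betti betti_imp_a_times_power by blast

end

theorem proposition4p4:
  fixes q :: rat and n :: nat and \<alpha> :: real
  assumes "q > 0"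
    and "q \<notin> \<int>"
    and "\<not> (\<exists>k::int. k \<noteq> 0 \<and> q = 1 / of_int k)"
    and "n \<ge> 1"
    and "\<alpha> > 0"
    and "irreducible_nth_root n q \<alpha>"
  shows "betti_elements (nat_adjoin \<alpha>) =
    {real_of_int (rat_num q) ^ (m + 1) / real_of_int (rat_den q) ^ m * \<alpha> ^ r
      | m r :: nat. r \<in> {0..n - 1}}"
proof -
  define a d where "a = nat (rat_num q)" and "d = nat (rat_den q)"
  have quot: "quotient_of q = (rat_num q, rat_den q)" by (simp add: rat_num_def rat_den_def)
  have den_pos: "rat_den q > 0" using quotient_of_denom_pos[OF quot] .
  have q_eq: "q = of_int (rat_num q) / of_int (rat_den q)" using quotient_of_div[OF quot] .
  have num_pos: "rat_num q > 0"
    using assms(1) den_pos q_eq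
    by (metis of_int_0_less_iff zero_less_divide_iff not_less_iff_gr_or_eq)
  have ad: "rat_num q = int a" "rat_den q = int d"
    using num_pos den_pos by (simp_all add: a_def d_def)
  have q: "q = of_nat a / of_nat d" using q_eq by (simp add: ad)
  \<comment> \<open>\<open>a = 1\<close> would make \<open>q\<close> the reciprocal of an integer,
    and \<open>d = 1\<close> would make it an integer; with positivity both are at least 2.\<close>
  have "a \<noteq> 1"
    using assms(3) q den_pos ad by (metis of_int_of_nat_eq of_nat_1 order_less_irrefl)
  moreover have "d \<noteq> 1" using assms(2) q by auto
  moreover have "coprime a d" using quotient_of_coprime[OF quot] by (simp add: ad)
  moreover have power_n: "\<alpha> ^ n = real a / real d"
    using assms(6) by (simp add: irreducible_nth_root_def q of_rat_divide)
  hence "real d * \<alpha> ^ n = real a" using den_pos ad by simp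
  moreover have "\<alpha> ^ k \<notin> \<rat>" if "1 \<le> k" "k < n" for k
    using assms(6) that by (simp add: irreducible_nth_root_def)
  moreover have "a > 0" "d > 0" using num_pos den_pos ad by simp_all
  ultimately interpret irreducible_root a d n \<alpha>
    using assms(4,5) by unfold_locales auto
  \<comment> \<open>\<open>\<alpha> ^ n = a / d\<close> turns \<open>(a / d) ^ m\<close> into
    \<open>\<alpha> ^ (n * m)\<close>. Division with remainder by \<open>n\<close> then reaches
    every exponent.\<close>
  have power: "real a ^ (m + 1) / real d ^ m * \<alpha> ^ r = real a * \<alpha> ^ (n * m + r)" for m r
    by (simp add: power_add power_mult power_n power_divide)
  have "\<exists>m r. r \<le> n - 1 \<and> i = n * m + r" for i
    using n_pos by (intro exI[of _ "i div n"] exI[of _ "i mod n"])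
      (auto simp: less_Suc_eq_le[symmetric])
  thus ?thesis unfolding betti_elements_eq ad of_int_of_nat_eq power
    by (auto, metis)
qed

end
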